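(* Let $p,q\ge 0$ be integers with $p\le q+1$, and let $\mathbf{a}=(a_1,\dots,a_p)$, $\mathbf{b}=(b_1,\dots,b_q)$ be vectors with positive components. For $\mu\ge0$ let $$f(\mu;x)=\frac{\Gamma(\mathbf{a}+\mu)}{\Gamma(\mathbf{b}+\mu)}\,{}_pF_q(\mathbf{a}+\mu;\mathbf{b}+\mu;x)=\sum_{n=0}^{\infty}\frac{\Gamma(\mathbf{a}+\mu+n)}{\Gamma(\mathbf{b}+\mu+n)}\frac{x^n}{n!},$$ and for $\alpha,\beta\ge0$ let $$\Delta_f(\alpha,\beta;x)=f(\mu+\alpha;x)f(\mu+\beta;x)-f(\mu;x)f(\mu+\alpha+\beta;x)=\sum_{m=0}^{\infty}\delta_m x^m .$$ (i) Suppose $p\le q$ and $$\frac{e_q(\mathbf{b})}{e_p(\mathbf{a})}\le\frac{e_{q-1}(\mathbf{b})}{e_{p-1}(\mathbf{a})}\le\cdots\le\frac{e_{q-p+1}(\mathbf{b})}{e_1(\mathbf{a})}\le e_{q-p}(\mathbf{b}).$$ Then $\Delta_f(\alpha,\beta;x)\ge0$ for all $x\ge0$, $\mu,\beta\ge0$ and $\alpha\in\mathbb{N}$. Moreover, if $\alpha\le\beta+1$, then $\delta_m\ge0$ for all integers $m\ge0$. (ii) Suppose $p\ge q$ and $$\frac{e_p(\mathbf{a})}{e_q(\mathbf{b})}\le\frac{e_{p-1}(\mathbf{a})}{e_{q-1}(\mathbf{b})}\le\cdots\le\frac{e_{p-q+1}(\mathbf{a})}{e_1(\mathbf{b})}\le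 e_{p-q}(\mathbf{a}).$$ Then $\Delta_f(\alpha,\beta;x)\le0$ for all $x\ge0$ (with $x<1$ if $p=q+1$), $\mu,\beta\ge0$ and $\alpha\in\mathbb{N}$. Moreover, if $\alpha\le\beta+1$, then $\delta_m\le0$ for all integers $m\ge0$.
   Context: ${}_pF_q(\mathbf{a};\mathbf{b};z)=\sum_{n\ge0}\frac{(a_1)_n\cdots(a_p)_n}{(b_1)_n\cdots(b_q)_n\,n!}z^n$ is the generalized hypergeometric function, with $(a)_n=\Gamma(a+n)/\Gamma(a)$; the series converges for all $z$ if $p\le q$ and for $|z|<1$ if $p=q+1$. Write $\Gamma(\mathbf{a})=\prod_i\Gamma(a_i)$ and $\mathbf{a}+\mu=(a_1+\mu,\dots,a_p+\mu)$; empty products equal $1$. $e_m(\mathbf{c})=e_m(c_1,\dots,c_r)$ denotes the $m$-th elementary symmetric polynomial, with $e_0=1$. The chain in (i) means $e_{q-p+j}(\mathbf{b})/e_j(\mathbf{a})\le e_{q-p+j-1}(\mathbf{b})/e_{j-1}(\mathbf{a})$ for $j=1,\dots,p$; the chain in (ii) means $e_{p-q+j}(\mathbf{a})/e_j(\mathbf{b})\le e_{p-q+j-1}(\mathbf{a})/e_{j-1}(\mathbf{b})$ for $j=1,\dots,q$. $\mathbb{N}$ is the set of positive integers. The coefficients $\delta_m$ depend on $\mathbf{a},\mathbf{b},\mu,\alpha,\beta$. *)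

theory Defs
  imports "HOL-Analysis.Analysis" "HOL-Real_Asymp.Real_Asymp"
begin

text \<open>Summing over index sets rather than over sets of values keeps repeated entries of \<open>c\<close> apart.\<close>

definition elem_sym :: "nat \<Rightarrow> real list \<Rightarrow> real" where
  "elem_sym m c = (\<Sum>S | S \<subseteq> {..<length c} \<and> card S = m. \<Prod>i\<in>S. c ! i)"

definition vec_shift :: "real list \<Rightarrow> real \<Rightarrow> real list" where
  "vec_shift c \<mu> = map (\<lambda>t. t + \<mu>) c"

definition Gamma_prod :: "real list \<Rightarrow> real" where
  "Gamma_prod c = prod_list (map Gamma c)"

definition hypergeo :: "real list \<Rightarrow> real list \<Rightarrow> real \<Rightarrow> real" where
  "hypergeo a b z = eval_fps (fps_hypergeo a b 1) z"

definition hyp_f :: "real list \<Rightarrow> real list \<Rightarrow> real \<Rightarrow> real \<Rightarrow> real" where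
  "hyp_f a b \<mu> x =
     Gamma_prod (vec_shift a \<mu>) / Gamma_prod (vec_shift b \<mu>) * hypergeo (vec_shift a \<mu>) (vec_shift b \<mu>) x"

definition Delta_f :: "real list \<Rightarrow> real list \<Rightarrow> real \<Rightarrow> real \<Rightarrow> real \<Rightarrow> real \<Rightarrow> real" where
  "Delta_f a b \<mu> \<alpha> \<beta> x =
     hyp_f a b (\<mu> + \<alpha>) x * hyp_f a b (\<mu> + \<beta>) x - hyp_f a b \<mu> x * hyp_f a b (\<mu> + \<alpha> + \<beta>) x"

definition fps_f :: "real list \<Rightarrow> real list \<Rightarrow> real \<Rightarrow> real fps" where
  "fps_f a b \<mu> =
     Abs_fps (\<lambda>n. Gamma_prod (vec_shift a (\<mu> + real n)) / Gamma_prod (vec_shift b (\<mu> + real n)) / fact n)"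

text \<open>
  The coefficients \<open>\<delta>\<^sub>m\<close> are those of the Cauchy product; \<open>Delta_f_sums\<close> below shows that they are
  the coefficients of the power series of \<^const>\<open>Delta_f\<close> throughout its region of convergence.
\<close>

definition delta_coeff :: "real list \<Rightarrow> real list \<Rightarrow> real \<Rightarrow> real \<Rightarrow> real \<Rightarrow> nat \<Rightarrow> real" where
  "delta_coeff a b \<mu> \<alpha> \<beta> m =
     fps_nth (fps_f a b (\<mu> + \<alpha>) * fps_f a b (\<mu> + \<beta>) - fps_f a b \<mu> * fps_f a b (\<mu> + \<alpha> + \<beta>)) m"

lemma hypergeo_series:
  "hypergeo a b z =
     (\<Sum>n. (\<Prod>t\<leftarrow>a. pochhammer t n) / ((\<Prod>t\<leftarrow>b. pochhammer t n) * fact n) * z ^ n)"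
proof -
  have fl: "foldl (\<lambda>r t. r * pochhammer t n) v c = v * (\<Prod>t\<leftarrow>c. pochhammer t n)"
    for v :: real and c n
    by (induction c arbitrary: v) (simp_all add: mult_ac)
  show ?thesis
    unfolding hypergeo_def eval_fps_def fps_hypergeo_nth fl by simp
qed

lemma Gamma_prod_pos: "\<forall>t\<in>set c. 0 < t \<Longrightarrow> 0 < Gamma_prod c"
  unfolding Gamma_prod_def by (induction c) (auto intro: Gamma_real_pos)

lemma Gamma_prod_vec_shift_pos:
  assumes "\<forall>t\<in>set c. 0 < t" "0 \<le> \<mu>"
  shows "0 < Gamma_prod (vec_shift c \<mu>)"
  using assms by (intro Gamma_prod_pos) (auto simp: vec_shift_def intro: add_pos_nonneg)

lemma Gamma_prod_vec_shift_Suc: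
  assumes "\<forall>t\<in>set c. 0 < t" "0 \<le> \<mu>"
  shows "Gamma_prod (vec_shift c (\<mu> + 1)) = (\<Prod>t\<leftarrow>c. t + \<mu>) * Gamma_prod (vec_shift c \<mu>)"
  using assms
proof (induction c)
  case (Cons t c)
  have "t + \<mu> \<notin> \<int>\<^sub>\<le>\<^sub>0"
    using Cons.prems by (auto dest: nonpos_Ints_nonpos)
  hence "Gamma (t + (\<mu> + 1)) = (t + \<mu>) * Gamma (t + \<mu>)"
    using Gamma_plus1[of "t + \<mu>"] by (simp add: add.assoc)
  with Cons show ?case
    by (simp add: Gamma_prod_def vec_shift_def)
qed (simp add: Gamma_prod_def vec_shift_def)

lemma Gamma_prod_vec_shift_add:
  assumes "\<forall>t\<in>set c. 0 < t" "0 \<le> \<mu>"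
  shows "Gamma_prod (vec_shift c (\<mu> + real n)) =
    Gamma_prod (vec_shift c \<mu>) * (\<Prod>t\<leftarrow>vec_shift c \<mu>. pochhammer t n)"
  using assms
proof (induction c)
  case (Cons t c)
  have "t + \<mu> \<notin> \<int>\<^sub>\<le>\<^sub>0" "Gamma (t + \<mu>) \<noteq> 0"
    using Cons.prems by (auto elim!: nonpos_Ints_cases simp: Gamma_eq_zero_iff)
  hence "Gamma (t + \<mu> + real n) = Gamma (t + \<mu>) * pochhammer (t + \<mu>) n"
    by (simp add: pochhammer_Gamma)
  with Cons show ?case
    by (simp add: Gamma_prod_def vec_shift_def add.assoc)
qed (simp add: Gamma_prod_def vec_shift_def)

lemma fps_f_eq:
  assumes "\<forall>t\<in>set a. 0 < t" "\<forall>t\<in>set b. 0 < t" "0 \<le> \<mu>"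
  shows "fps_f a b \<mu> = fps_const (Gamma_prod (vec_shift a \<mu>) / Gamma_prod (vec_shift b \<mu>))
    * fps_hypergeo (vec_shift a \<mu>) (vec_shift b \<mu>) 1"
proof -
  have fl: "foldl (\<lambda>r t. r * pochhammer t n) v c = v * (\<Prod>t\<leftarrow>c. pochhammer t n)"
    for v :: real and c n
    by (induction c arbitrary: v) (simp_all add: mult_ac)
  show ?thesis
    by (simp add: fps_eq_iff fps_f_def fl Gamma_prod_vec_shift_add assms)
qed

lemma prod_list_shift_pos: "\<forall>t\<in>set c. 0 < t + \<nu> \<Longrightarrow> 0 < (\<Prod>t\<leftarrow>c. t + (\<nu>::real))"
  by (induction c) auto

lemma tendsto_prod_list_shift:
  "(\<lambda>n. (\<Prod>t\<leftarrow>c. t + (\<mu> + real n)) / real n ^ length c) \<longlonglongrightarrow> 1"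
proof (induction c)
  case (Cons t c)
  have "(\<lambda>n. (t + (\<mu> + real n)) / real n) \<longlonglongrightarrow> 1"
    by real_asymp
  from tendsto_mult[OF this Cons] show ?case
    by simp
qed simp

lemma conv_radius_fps_f:
  assumes "\<forall>t\<in>set a. 0 < t" "\<forall>t\<in>set b. 0 < t" "0 \<le> \<mu>" "length a \<le> length b + 1"
  shows "fps_conv_radius (fps_f a b \<mu>) = (if length a \<le> length b then \<infinity> else 1)"
proof -
  let ?A = "\<lambda>n. \<Prod>t\<leftarrow>a. t + (\<mu> + real n)" and ?B = "\<lambda>n. \<Prod>t\<leftarrow>b. t + (\<mu> + real n)"
  let ?f = "fps_nth (fps_f a b \<mu>)"
  let ?g = "\<lambda>n. (real n + 1) / real n * (?B n / real n ^ length b) / (?A n / real n ^ length a)"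
  have pos: "0 < ?f n" for n
    using assms by (simp add: fps_f_def Gamma_prod_vec_shift_pos)
  have ratio: "norm (?f n) / norm (?f (Suc n)) = (real n + 1) * ?B n / ?A n" for n
  proof -
    have "0 < Gamma_prod (vec_shift a (\<mu> + real n))" "0 < Gamma_prod (vec_shift b (\<mu> + real n))"
      using assms by (simp_all add: Gamma_prod_vec_shift_pos)
    moreover have "0 < ?A n" "0 < ?B n"
      using assms by (auto intro!: prod_list_shift_pos)
    moreover have "Gamma_prod (vec_shift a (\<mu> + real (Suc n))) = ?A n * Gamma_prod (vec_shift a (\<mu> + real n))"
        "Gamma_prod (vec_shift b (\<mu> + real (Suc n))) = ?B n * Gamma_prod (vec_shift b (\<mu> + real n))"
      using assms Gamma_prod_vec_shift_Suc[of _ "\<mu> + real n"] by (simp_all add: add_ac)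
    ultimately show ?thesis
      by (simp add: fps_f_def abs_mult field_simps del: of_nat_Suc) (simp add: field_simps)
  qed
  have "(\<lambda>n. (real n + 1) / real n) \<longlonglongrightarrow> 1"
    by real_asymp
  hence g: "?g \<longlonglongrightarrow> 1"
    using tendsto_divide[OF tendsto_mult[OF _ tendsto_prod_list_shift[where c = b and \<mu> = \<mu>]] tendsto_prod_list_shift[where c = a and \<mu> = \<mu>]]
    by fastforce
  have "(\<lambda>n. ereal (norm (?f n) / norm (?f (Suc n))))
    \<longlonglongrightarrow> (if length a \<le> length b then \<infinity> else 1)"
  proof (cases "length a \<le> length b")
    case True
    have "filterlim (\<lambda>n. ?g n * real n ^ (Suc (length b) - length a)) at_top sequentially"
      using True
      by (intro filterlim_tendsto_pos_mult_at_top[OF g] filterlim_pow_at_top filterlim_real_sequentially) auto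
    moreover have "eventually (\<lambda>n. ?g n * real n ^ (Suc (length b) - length a) =
        norm (?f n) / norm (?f (Suc n))) sequentially"
      using eventually_gt_at_top[of 0]
    proof eventually_elim
      case (elim n)
      have "real n * real n ^ length b = real n ^ length a * real n ^ (Suc (length b) - length a)"
        using True by (simp flip: power_Suc power_add)
      hence "real n ^ (Suc (length b) - length a) = real n * real n ^ length b / real n ^ length a"
        using elim by (simp add: field_simps)
      thus ?case
        unfolding ratio using elim by simp
    qed
    ultimately have "filterlim (\<lambda>n. norm (?f n) / norm (?f (Suc n))) at_top sequentially"
      by (rule filterlim_mono_eventually[OF _ order.refl order.refl])
    thus ?thesis
      using True by (simp add: tendsto_PInfty_eq_at_top)
  next
    case False
    hence len: "length a = Suc (length b)"
      using assms(4) by simp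
    have "eventually (\<lambda>n. ?g n = norm (?f n) / norm (?f (Suc n))) sequentially"
      using eventually_gt_at_top[of 0]
      by eventually_elim (simp only: ratio, simp add: len)
    with g have "(\<lambda>n. norm (?f n) / norm (?f (Suc n))) \<longlonglongrightarrow> 1"
      by (rule Lim_transform_eventually)
    thus ?thesis
      using False by (simp add: one_ereal_def)
  qed
  moreover have "eventually (\<lambda>n. ?f n \<noteq> 0) sequentially"
    using pos by (simp add: less_imp_neq[symmetric])
  ultimately show ?thesis
    unfolding fps_conv_radius_def by (intro conv_radius_ratio_limit_ereal)
qed

lemma hyp_f_eq_eval_fps:
  assumes "\<forall>t\<in>set a. 0 < t" "\<forall>t\<in>set b. 0 < t" "0 \<le> \<mu>" "length a \<le> length b + 1"
    and "length a = length b + 1 \<longrightarrow> \<bar>x\<bar> < 1"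
  shows "hyp_f a b \<mu> x = eval_fps (fps_f a b \<mu>) x"
proof -
  have r: "ereal (norm x) < fps_conv_radius (fps_f a b \<mu>)"
    using assms by (auto simp: conv_radius_fps_f)
  have nz: "Gamma_prod (vec_shift a \<mu>) / Gamma_prod (vec_shift b \<mu>) \<noteq> 0"
    using assms(1-3) by (simp add: Gamma_prod_vec_shift_pos less_imp_neq[symmetric])
  have "ereal (norm x) < fps_conv_radius (fps_hypergeo (vec_shift a \<mu>) (vec_shift b \<mu>) 1)"
    using r nz unfolding fps_f_eq[OF assms(1-3)] by (simp add: fps_conv_radius_cmult_left)
  thus ?thesis
    unfolding fps_f_eq[OF assms(1-3)] hyp_f_def hypergeo_def by (simp add: eval_fps_mult)
qed

lemma hyp_f_sums:
  assumes "\<forall>t\<in>set a. 0 < t" "\<forall>t\<in>set b. 0 < t" "0 \<le> \<mu>" "length a \<le> length b + 1"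
    and "length a = length b + 1 \<longrightarrow> \<bar>x\<bar> < 1"
  shows "(\<lambda>n. Gamma_prod (vec_shift a (\<mu> + real n)) / Gamma_prod (vec_shift b (\<mu> + real n)) * x ^ n / fact n)
    sums hyp_f a b \<mu> x"
proof -
  have "ereal (norm x) < fps_conv_radius (fps_f a b \<mu>)"
    using assms by (auto simp: conv_radius_fps_f)
  from sums_eval_fps[OF this] show ?thesis
    unfolding hyp_f_eq_eval_fps[OF assms] by (simp add: fps_f_def)
qed

lemma Delta_f_sums:
  assumes "\<forall>t\<in>set a. 0 < t" "\<forall>t\<in>set b. 0 < t" "length a \<le> length b + 1"
    and "0 \<le> \<mu>" "0 \<le> \<alpha>" "0 \<le> \<beta>"
    and "length a = length b + 1 \<longrightarrow> \<bar>x\<bar> < 1"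
  shows "(\<lambda>m. delta_coeff a b \<mu> \<alpha> \<beta> m * x ^ m) sums Delta_f a b \<mu> \<alpha> \<beta> x"
proof -
  let ?P = "fps_f a b (\<mu> + \<alpha>) * fps_f a b (\<mu> + \<beta>)"
  let ?Q = "fps_f a b \<mu> * fps_f a b (\<mu> + \<alpha> + \<beta>)"
  have r: "ereal (norm x) < fps_conv_radius (fps_f a b \<nu>)" if "0 \<le> \<nu>" for \<nu>
    using assms that by (auto simp: conv_radius_fps_f)
  have rP: "ereal (norm x) < fps_conv_radius ?P"
    by (rule less_le_trans[OF _ fps_conv_radius_mult]) (use assms r in auto)
  have rQ: "ereal (norm x) < fps_conv_radius ?Q"
    by (rule less_le_trans[OF _ fps_conv_radius_mult]) (use assms r in auto)
  have "ereal (norm x) < fps_conv_radius (?P - ?Q)"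
    by (rule less_le_trans[OF _ fps_conv_radius_diff]) (use rP rQ in auto)
  from sums_eval_fps[OF this]
  have "(\<lambda>m. delta_coeff a b \<mu> \<alpha> \<beta> m * x ^ m) sums eval_fps (?P - ?Q) x"
    by (simp add: delta_coeff_def)
  also have "eval_fps (?P - ?Q) x = Delta_f a b \<mu> \<alpha> \<beta> x"
    using assms rP rQ r by (simp add: eval_fps_diff eval_fps_mult Delta_f_def hyp_f_eq_eval_fps)
  finally show ?thesis .
qed

end

theory Submission
  imports Defs
begin

text \<open>
  With \<open>h s = Gamma_prod (vec_shift a s) / Gamma_prod (vec_shift b s)\<close>, the coefficients of
  \<open>hyp_f a b \<mu>\<close> are \<open>h (\<mu> + n) / n!\<close>, and the whole theorem is about one property of \<open>h\<close>: the ratio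
  \<open>h (s + 1) / h s = (\<Prod>t\<leftarrow>a. t + s) / (\<Prod>t\<leftarrow>b. t + s)\<close> is monotone in \<open>s \<ge> 0\<close>.

  The chains of elementary symmetric polynomials say that the coefficientwise quotients of the two
  polynomials in this ratio are monotone, and a quotient of polynomials with nonnegative coefficients
  inherits this monotonicity (\<open>prod_shift_cross_mono\<close>). Multiplying up ratios along integer steps, a
  nonincreasing ratio gives \<open>h s * h (t + n) \<le> h (s + n) * h t\<close> for \<open>s \<le> t\<close> and natural \<open>n\<close>
  (\<open>Gamma_ratio_log_concave\<close>). Case (ii) is the same fact for \<open>1 / h\<close>, that is, with \<open>a\<close> and \<open>b\<close>
  exchanged.

  It remains to pass from \<open>h\<close> to \<open>\<delta>\<^sub>m\<close>. Put \<open>M = m + \<alpha>\<close> and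
  \<open>A j = h (\<mu> + j) * h (\<mu> + \<beta> + (M - j))\<close>. Then
  \<open>m! * \<delta>\<^sub>m = (\<Sum>k\<le>m. (m choose k) * (A (k + \<alpha>) - A k))\<close>, so \<open>A j\<close> has the weight
  \<open>(m choose (j - \<alpha>)) - (m choose j)\<close>. Under \<open>j \<mapsto> M - j\<close> this weight changes sign, and it is nonpositive
  for \<open>j \<le> M / 2\<close> because \<open>j\<close> is then at least as close to \<open>m / 2\<close> as \<open>j - \<alpha>\<close> is. Pairing \<open>j\<close> with \<open>M - j\<close> leaves
  only the differences \<open>A (M - j) - A j\<close> with nonnegative weights, and their sign is that given by the
  log-concavity (or log-convexity) of \<open>h\<close> with step \<open>M - 2 * j\<close>. The sign of
  \<open>Delta_f\<close> at \<open>x \<ge> 0\<close> then follows from that of the \<open>\<delta>\<^sub>m\<close> by summing the power series.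
\<close>

section \<open>Elementary symmetric polynomials and ratios of products\<close>

lemma elem_sym_pos:
  assumes "\<forall>t\<in>set c. 0 < t" and "m \<le> length c"
  shows "0 < elem_sym m c"
proof -
  have "{S. S \<subseteq> {..<length c} \<and> card S = m} \<noteq> {}"
    using assms(2) obtain_subset_with_card_n[of m "{..<length c}"] by auto
  moreover have "finite {S. S \<subseteq> {..<length c} \<and> card S = m}"
    by (rule finite_subset[of _ "Pow {..<length c}"]) auto
  ultimately show ?thesis
    unfolding elem_sym_def using assms(1)
    by (intro sum_pos prod_pos) (auto intro!: nth_mem)
qed

lemma prod_shift_eq_elem_sym:
  "(\<Prod>t\<leftarrow>c. t + s) = (\<Sum>k\<le>length c. elem_sym (length c - k) c * s ^ k)"
proof -
  let ?n = "length c"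
  let ?T = "\<lambda>S. (\<Prod>i\<in>S. c ! i) * s ^ (?n - card S)"
  have "(\<Prod>t\<leftarrow>c. t + s) = (\<Prod>i<?n. c ! i + s)"
    by (simp add: prod.list_conv_set_nth atLeast0LessThan)
  also have "\<dots> = (\<Sum>S\<in>Pow {..<?n}. (\<Prod>i\<in>S. c ! i) * (\<Prod>i\<in>{..<?n} - S. s))"
    by (rule prod_add) simp
  also have "\<dots> = (\<Sum>S\<in>Pow {..<?n}. ?T S)"
    by (intro sum.cong refl) (auto simp: card_Diff_subset finite_subset)
  also have "\<dots> = (\<Sum>m\<le>?n. \<Sum>S | S \<in> Pow {..<?n} \<and> card S = m. ?T S)"
  proof (rule sum.group[symmetric])
    show "card ` Pow {..<?n} \<subseteq> {..?n}"
      using card_mono[of "{..<?n}"] by fastforce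
  qed auto
  also have "\<dots> = (\<Sum>m\<le>?n. elem_sym m c * s ^ (?n - m))"
    unfolding elem_sym_def by (intro sum.cong refl) (auto simp: sum_distrib_right intro!: sum.cong)
  also have "\<dots> = (\<Sum>k\<le>?n. elem_sym (?n - k) c * s ^ k)"
    by (rule sum.reindex_bij_witness[of _ "\<lambda>k. ?n - k" "\<lambda>k. ?n - k"]) auto
  finally show ?thesis .
qed

text \<open>
  The difference of the two sides, symmetrised in the summation indices \<open>k\<close> and \<open>l\<close>, is half the sum of
  \<open>(B l * A k - B k * A l) * (t ^ l * s ^ k - t ^ k * s ^ l)\<close>;
  both factors are nonnegative for \<open>k \<le> l\<close> and nonpositive for \<open>l \<le> k\<close>.
\<close>

lemma polynomial_cross_mono:
  fixes A B :: "nat \<Rightarrow> real"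
  assumes cross: "\<And>k l. k \<le> l \<Longrightarrow> l \<le> n \<Longrightarrow> B k * A l \<le> B l * A k"
    and st: "0 \<le> s" "s \<le> t"
  shows "(\<Sum>k\<le>n. B k * s ^ k) * (\<Sum>l\<le>n. A l * t ^ l) \<le> (\<Sum>k\<le>n. B k * t ^ k) * (\<Sum>l\<le>n. A l * s ^ l)"
proof -
  let ?D = "\<lambda>k l. B k * A l * (t ^ k * s ^ l - s ^ k * t ^ l)"
  have pow: "t ^ k * s ^ l \<le> t ^ l * s ^ k" if "k \<le> l" for k l
  proof -
    have "(t * s) ^ k * s ^ (l - k) \<le> (t * s) ^ k * t ^ (l - k)"
      using st by (intro mult_left_mono power_mono) auto
    moreover have "(t * s) ^ k * s ^ (l - k) = t ^ k * s ^ l" "(t * s) ^ k * t ^ (l - k) = t ^ l * s ^ k"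
      using that by (simp_all add: power_mult_distrib mult_ac flip: power_add)
    ultimately show ?thesis
      by simp
  qed
  have summand: "0 \<le> ?D k l + ?D l k" if "k \<le> n" "l \<le> n" for k l
  proof -
    have eq: "?D k l + ?D l k = (B l * A k - B k * A l) * (t ^ l * s ^ k - t ^ k * s ^ l)"
      by (simp add: algebra_simps)
    show ?thesis
    proof (cases "k \<le> l")
      case True
      thus ?thesis
        unfolding eq using cross[of k l] pow[of k l] that by (intro mult_nonneg_nonneg) auto
    next
      case False
      thus ?thesis
        unfolding eq using cross[of l k] pow[of l k] that by (intro mult_nonpos_nonpos) auto
    qed
  qed
  have "(\<Sum>k\<le>n. B k * t ^ k) * (\<Sum>l\<le>n. A l * s ^ l) - (\<Sum>k\<le>n. B k * s ^ k) * (\<Sum>l\<le>n. A l * t ^ l)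
      = (\<Sum>k\<le>n. \<Sum>l\<le>n. ?D k l)" (is "?L = ?S")
    unfolding sum_product sum_subtractf[symmetric] by (intro sum.cong refl) (simp add: algebra_simps)
  moreover have "2 * ?S = (\<Sum>k\<le>n. \<Sum>l\<le>n. ?D k l + ?D l k)"
    using sum.swap[of ?D "{..n}" "{..n}"] by (simp add: sum.distrib)
  moreover have "0 \<le> (\<Sum>k\<le>n. \<Sum>l\<le>n. ?D k l + ?D l k)"
    by (intro sum_nonneg summand) auto
  ultimately show ?thesis
    by linarith
qed

text \<open>
  The chain condition of the theorem, for a shorter list \<open>c\<close> and a longer list \<open>d\<close>. Part (i) uses it
  for \<open>c = a\<close> and \<open>d = b\<close>, part (ii) for \<open>c = b\<close> and \<open>d = a\<close>.
\<close>

definition elem_sym_chain :: "real list \<Rightarrow> real list \<Rightarrow> bool" where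
  "elem_sym_chain c d \<longleftrightarrow> length c \<le> length d \<and>
     (\<forall>j\<in>{1..length c}. elem_sym (length d - length c + j) d / elem_sym j c
        \<le> elem_sym (length d - length c + j - 1) d / elem_sym (j - 1) c)"

lemma elem_sym_chain_antimono:
  assumes chain: "elem_sym_chain c d" and pos: "\<forall>t\<in>set c. 0 < t"
    and ij: "i \<le> j" "j \<le> length c"
  shows "elem_sym (length d - length c + j) d * elem_sym i c
       \<le> elem_sym (length d - length c + i) d * elem_sym j c"
proof -
  let ?r = "\<lambda>j. elem_sym (length d - length c + j) d / elem_sym j c"
  have "?r j \<le> ?r i"
    using ij
  proof (induction j rule: dec_induct)
    case (step n)
    have "?r (Suc n) \<le> ?r n"
      using chain step by (auto simp: elem_sym_chain_def dest!: bspec[of _ _ "Suc n"])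
    with step show ?case
      by simp
  qed simp
  thus ?thesis
    using elem_sym_pos[OF pos] ij by (simp add: field_simps)
qed

text \<open>
  Comparing coefficients of \<open>s ^ k\<close> turns the chain into the hypothesis of \<open>polynomial_cross_mono\<close>; the
  coefficients of the shorter product are padded by zeros up to the degree of the longer one.
\<close>

lemma prod_shift_cross_mono:
  assumes chain: "elem_sym_chain c d"
    and pos: "\<forall>t\<in>set c. 0 < t" "\<forall>t\<in>set d. 0 < t" and st: "0 \<le> s" "s \<le> t"
  shows "(\<Prod>u\<leftarrow>d. u + s) * (\<Prod>u\<leftarrow>c. u + t) \<le> (\<Prod>u\<leftarrow>d. u + t) * (\<Prod>u\<leftarrow>c. u + s)"
proof -
  let ?p = "length c" and ?q = "length d"
  define A where "A k = (if k \<le> ?p then elem_sym (?p - k) c else 0)" for k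
  define B where "B k = elem_sym (?q - k) d" for k
  have le: "?p \<le> ?q"
    using chain by (simp add: elem_sym_chain_def)
  have c_eq: "(\<Prod>u\<leftarrow>c. u + v) = (\<Sum>k\<le>?q. A k * v ^ k)" for v
    unfolding prod_shift_eq_elem_sym A_def using le by (intro sum.mono_neutral_cong_left) auto
  have d_eq: "(\<Prod>u\<leftarrow>d. u + v) = (\<Sum>k\<le>?q. B k * v ^ k)" for v
    unfolding prod_shift_eq_elem_sym B_def by simp
  have "B k * A l \<le> B l * A k" if kl: "k \<le> l" "l \<le> ?q" for k l
  proof (cases "l \<le> ?p")
    case True
    thus ?thesis
      using elem_sym_chain_antimono[OF chain pos(1), of "?p - l" "?p - k"] kl le
      by (simp add: A_def B_def)
  next
    case False
    moreover have "0 \<le> B l" "0 \<le> A k"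
      using elem_sym_pos[OF pos(1)] elem_sym_pos[OF pos(2)]
      by (auto simp: A_def B_def intro!: less_imp_le)
    ultimately show ?thesis
      by (simp add: A_def)
  qed
  thus ?thesis
    unfolding c_eq d_eq by (rule polynomial_cross_mono) (use st in auto)
qed

section \<open>Log-concavity of ratios of gamma functions along integer steps\<close>

definition Gamma_ratio :: "real list \<Rightarrow> real list \<Rightarrow> real \<Rightarrow> real" where
  "Gamma_ratio a b s = Gamma_prod (vec_shift a s) / Gamma_prod (vec_shift b s)"

lemma log_concave_nat_step:
  fixes h :: "real \<Rightarrow> real"
  assumes pos: "\<And>s. 0 \<le> s \<Longrightarrow> 0 < h s"
    and step: "\<And>s t. 0 \<le> s \<Longrightarrow> s \<le> t \<Longrightarrow> h s * h (t + 1) \<le> h (s + 1) * h t"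
    and st: "0 \<le> s" "s \<le> t"
  shows "h s * h (t + real n) \<le> h (s + real n) * h t"
proof (induction n)
  case (Suc n)
  let ?s = "s + real n" and ?t = "t + real n"
  have p: "0 < h s" "0 < h t" "0 < h ?s" "0 < h ?t" "0 < h (?s + 1)" "0 < h (?t + 1)"
    using st by (auto intro!: pos)
  \<comment> \<open>As quotients: \<open>h (t + n) / h t \<le> h (s + n) / h s\<close> by induction, times the ratios of one more step.\<close>
  have "h ?t / h t * (h (?t + 1) / h ?t) \<le> h ?s / h s * (h (?s + 1) / h ?s)"
  proof (rule mult_mono)
    show "h ?t / h t \<le> h ?s / h s"
      using Suc p by (simp add: field_simps)
    show "h (?t + 1) / h ?t \<le> h (?s + 1) / h ?s"
      using step[of ?s ?t] st p by (simp add: field_simps)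
  qed (use p in auto)
  hence "h (?t + 1) / h t \<le> h (?s + 1) / h s"
    using p by simp
  thus ?case
    using p by (simp add: field_simps)
qed simp

lemma Gamma_ratio_log_concave:
  assumes chain: "elem_sym_chain c d"
    and pos: "\<forall>t\<in>set c. 0 < t" "\<forall>t\<in>set d. 0 < t" and st: "0 \<le> s" "s \<le> t"
  shows "Gamma_ratio c d s * Gamma_ratio c d (t + real n) \<le> Gamma_ratio c d (s + real n) * Gamma_ratio c d t"
proof (rule log_concave_nat_step)
  show "0 < Gamma_ratio c d s" if "0 \<le> s" for s
    using that pos by (simp add: Gamma_ratio_def Gamma_prod_vec_shift_pos)
next
  fix s t :: real
  assume st: "0 \<le> s" "s \<le> t"
  let ?h = "Gamma_ratio c d"
  let ?C = "\<lambda>v. \<Prod>u\<leftarrow>c. u + v" and ?D = "\<lambda>v. \<Prod>u\<leftarrow>d. u + v"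
  have p: "0 < ?h v" "0 < ?C v" "0 < ?D v" if "0 \<le> v" for v
    using that pos by (auto simp: Gamma_ratio_def Gamma_prod_vec_shift_pos add_pos_nonneg
        intro!: prod_list_shift_pos)
  have rec: "?h (v + 1) = ?C v / ?D v * ?h v" if "0 \<le> v" for v
    using that pos by (simp add: Gamma_ratio_def Gamma_prod_vec_shift_Suc)
  have "?C t / ?D t \<le> ?C s / ?D s"
    using prod_shift_cross_mono[OF chain pos st] p[of s] p[of t] st by (simp add: field_simps)
  hence "?C t / ?D t * (?h s * ?h t) \<le> ?C s / ?D s * (?h s * ?h t)"
    using p[of s] p[of t] st by (intro mult_right_mono) auto
  thus "?h s * ?h (t + 1) \<le> ?h (s + 1) * ?h t"
    using st by (simp add: rec mult_ac)
qed (use st in auto)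

lemma Gamma_ratio_log_convex:
  assumes chain: "elem_sym_chain d c"
    and pos: "\<forall>t\<in>set c. 0 < t" "\<forall>t\<in>set d. 0 < t" and st: "0 \<le> s" "s \<le> t"
  shows "Gamma_ratio c d (s + real n) * Gamma_ratio c d t \<le> Gamma_ratio c d s * Gamma_ratio c d (t + real n)"
proof -
  have inv: "Gamma_ratio d c v = inverse (Gamma_ratio c d v)" for v
    by (simp add: Gamma_ratio_def)
  have p: "0 < Gamma_ratio c d v" if "0 \<le> v" for v
    using that pos by (simp add: Gamma_ratio_def Gamma_prod_vec_shift_pos)
  show ?thesis
  proof (rule inverse_le_imp_le)
    show "inverse (Gamma_ratio c d s * Gamma_ratio c d (t + real n))
        \<le> inverse (Gamma_ratio c d (s + real n) * Gamma_ratio c d t)"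
      using Gamma_ratio_log_concave[OF chain pos(2,1) st, of n] by (simp add: inv)
    show "0 < Gamma_ratio c d s * Gamma_ratio c d (t + real n)"
      using st by (intro mult_pos_pos p) auto
  qed
qed

section \<open>Signs of the coefficients\<close>

text \<open>
  Both binomial coefficients decrease with the distance of the lower index from \<open>m / 2\<close>, and for
  \<open>2 * j \<le> m + n\<close> the index \<open>j\<close> is at most as far away as \<open>j - n\<close>.
\<close>

lemma binomial_shift_le:
  assumes "n \<le> j" and "2 * j \<le> m + n"
  shows "m choose (j - n) \<le> m choose j"
proof (cases "2 * j \<le> m")
  case True
  thus ?thesis
    by (intro binomial_mono) auto
next
  case False
  have "m choose (j - n) \<le> m choose (m - j)"
    using assms False by (intro binomial_mono) auto
  also have "\<dots> = m choose j"
    using assms by (intro binomial_symmetric[symmetric]) auto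
  finally show ?thesis .
qed

text \<open>
  Pairing \<open>j\<close> with \<open>M - j\<close> shows that twice the sum equals the sum of \<open>w j * (A j - A (M - j))\<close>. There the
  two factors are both nonpositive for \<open>2 * j \<le> M\<close>, and both nonnegative otherwise.
\<close>

lemma antisymmetric_weights_sum_nonneg:
  fixes w A :: "nat \<Rightarrow> real"
  assumes antisym: "\<And>j. j \<le> M \<Longrightarrow> w (M - j) = - w j"
    and nonpos: "\<And>j. 2 * j \<le> M \<Longrightarrow> w j \<le> 0"
    and refl_le: "\<And>j. 2 * j \<le> M \<Longrightarrow> A j \<le> A (M - j)"
  shows "0 \<le> (\<Sum>j\<le>M. w j * A j)"
proof -
  have pair: "0 \<le> w j * (A j - A (M - j))" if j: "j \<le> M" for j
  proof (cases "2 * j \<le> M")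
    case True
    hence "w j \<le> 0" "A j - A (M - j) \<le> 0"
      using nonpos[of j] refl_le[of j] by simp_all
    thus ?thesis
      by (rule mult_nonpos_nonpos)
  next
    case False
    hence "2 * (M - j) \<le> M"
      using j by simp
    hence "w (M - j) \<le> 0" "A (M - j) \<le> A (M - (M - j))"
      by (rule nonpos, rule refl_le)
    hence "0 \<le> w j" "0 \<le> A j - A (M - j)"
      using antisym[OF j] j by simp_all
    thus ?thesis
      by (rule mult_nonneg_nonneg)
  qed
  have "(\<Sum>j\<le>M. w j * A j) = (\<Sum>j\<le>M. w (M - j) * A (M - j))"
    by (rule sum.reindex_bij_witness[of _ "\<lambda>j. M - j" "\<lambda>j. M - j"]) simp_all
  also have "\<dots> = (\<Sum>j\<le>M. - w j * A (M - j))"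
    by (intro sum.cong refl) (simp add: antisym)
  finally have "2 * (\<Sum>j\<le>M. w j * A j) = (\<Sum>j\<le>M. w j * (A j - A (M - j)))"
    by (simp add: right_diff_distrib sum_subtractf sum_negf)
  moreover have "0 \<le> (\<Sum>j\<le>M. w j * (A j - A (M - j)))"
    by (rule sum_nonneg) (simp add: pair)
  ultimately show ?thesis
    by simp
qed

text \<open>
  The binomial weights on \<open>{0..m}\<close> and their translate by \<open>n\<close> are mirror images about \<open>(m + n) / 2\<close>, so
  their difference is antisymmetric. The case distinction makes the translate vanish to the left of
  \<open>n\<close>, where the truncated subtraction would give \<open>m choose 0\<close>.
\<close>

definition binomial_shift_weight :: "nat \<Rightarrow> nat \<Rightarrow> nat \<Rightarrow> real" where
  "binomial_shift_weight m n j = (if n \<le> j then real (m choose (j - n)) else 0) - real (m choose j)"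

lemma binomial_shift_weight_nonpos: "2 * j \<le> m + n \<Longrightarrow> binomial_shift_weight m n j \<le> 0"
  using binomial_shift_le[of n j m] by (simp add: binomial_shift_weight_def)

lemma binomial_shift_weight_mirror:
  assumes "j \<le> m + n"
  shows "binomial_shift_weight m n (m + n - j) = - binomial_shift_weight m n j"
proof -
  have "(if n \<le> m + n - j then real (m choose (m + n - j - n)) else 0) = real (m choose j)"
  proof (cases "j \<le> m")
    case True
    thus ?thesis
      using binomial_symmetric[of j m] by simp
  qed (use assms in \<open>simp add: binomial_eq_0\<close>)
  moreover have "real (m choose (m + n - j)) = (if n \<le> j then real (m choose (j - n)) else 0)"
  proof (cases "n \<le> j")
    case True
    hence "m - (j - n) = m + n - j"
      using assms by simp
    with True assms show ?thesis
      using binomial_symmetric[of "j - n" m] by simp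
  qed (simp add: binomial_eq_0)
  ultimately show ?thesis
    by (simp add: binomial_shift_weight_def)
qed

lemma sum_binomial_shift_weight:
  "(\<Sum>k\<le>m. real (m choose k) * (A (k + n) - A k)) = (\<Sum>j\<le>m + n. binomial_shift_weight m n j * A j)"
proof -
  have "(\<Sum>k\<le>m. real (m choose k) * A (k + n)) = (\<Sum>j\<in>{n..m + n}. real (m choose (j - n)) * A j)"
    by (rule sum.reindex_bij_witness[of _ "\<lambda>j. j - n" "\<lambda>k. k + n"]) auto
  also have "\<dots> = (\<Sum>j\<le>m + n. (if n \<le> j then real (m choose (j - n)) else 0) * A j)"
    by (rule sum.mono_neutral_cong_left) auto
  finally have up: "(\<Sum>k\<le>m. real (m choose k) * A (k + n)) = \<dots>" .
  have down: "(\<Sum>k\<le>m. real (m choose k) * A k) = (\<Sum>j\<le>m + n. real (m choose j) * A j)"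
    by (rule sum.mono_neutral_left) (auto simp: binomial_eq_0)
  show ?thesis
    by (simp only: right_diff_distrib sum_subtractf up down binomial_shift_weight_def left_diff_distrib)
qed

text \<open>
  The translated binomial weights are the smaller ones on the left half of \<open>{0..m + n}\<close> and the larger ones
  on the right half. So they give at least as large a mean to a function whose value at each point of
  the left half is at most that at the mirror image.
\<close>

lemma binomial_sum_shift_nonneg:
  fixes A :: "nat \<Rightarrow> real"
  assumes "\<And>j. 2 * j \<le> m + n \<Longrightarrow> A j \<le> A (m + n - j)"
  shows "0 \<le> (\<Sum>k\<le>m. real (m choose k) * (A (k + n) - A k))"
  unfolding sum_binomial_shift_weight
  by (intro antisymmetric_weights_sum_nonneg binomial_shift_weight_mirror binomial_shift_weight_nonpos assms)

definition mirror_product :: "(real \<Rightarrow> real) \<Rightarrow> real \<Rightarrow> real \<Rightarrow> nat \<Rightarrow> nat \<Rightarrow> real" where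
  "mirror_product h \<mu> \<beta> M j = h (\<mu> + real j) * h (\<mu> + \<beta> + real (M - j))"

lemma fact_mult_delta_coeff:
  fixes a b :: "real list" and \<mu> \<beta> :: real and n :: nat
  defines "A \<equiv> mirror_product (Gamma_ratio a b) \<mu> \<beta>"
  shows "fact m * delta_coeff a b \<mu> (real n) \<beta> m
    = (\<Sum>k\<le>m. real (m choose k) * (A (m + n) (k + n) - A (m + n) k))"
proof -
  have nth: "fps_nth (fps_f a b \<nu>) k = Gamma_ratio a b (\<nu> + real k) / fact k" for \<nu> k
    by (simp add: fps_f_def Gamma_ratio_def)
  have "fact m * delta_coeff a b \<mu> (real n) \<beta> m =
      (\<Sum>k\<le>m. fact m * (
        Gamma_ratio a b (\<mu> + real n + real k) / fact k * (Gamma_ratio a b (\<mu> + \<beta> + real (m - k)) / fact (m - k))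
      - Gamma_ratio a b (\<mu> + real k) / fact k * (Gamma_ratio a b (\<mu> + real n + \<beta> + real (m - k)) / fact (m - k))))"
    unfolding delta_coeff_def fps_sub_nth fps_mult_nth nth sum_subtractf[symmetric] sum_distrib_left
    by (simp only: atLeast0AtMost)
  also have "\<dots> = (\<Sum>k\<le>m. real (m choose k) * (A (m + n) (k + n) - A (m + n) k))"
  proof (intro sum.cong refl)
    fix k assume "k \<in> {..m}"
    hence k: "k \<le> m"
      by simp
    have bin: "real (m choose k) = fact m / (fact k * fact (m - k))"
      using k by (rule binomial_fact)
    have arg: "\<mu> + real (k + n) = \<mu> + real n + real k" "m + n - (k + n) = m - k"
      "\<mu> + \<beta> + real (m + n - k) = \<mu> + real n + \<beta> + real (m - k)"
      using k by auto
    show "fact m * (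
        Gamma_ratio a b (\<mu> + real n + real k) / fact k * (Gamma_ratio a b (\<mu> + \<beta> + real (m - k)) / fact (m - k))
      - Gamma_ratio a b (\<mu> + real k) / fact k * (Gamma_ratio a b (\<mu> + real n + \<beta> + real (m - k)) / fact (m - k)))
      = real (m choose k) * (A (m + n) (k + n) - A (m + n) k)"
      unfolding A_def mirror_product_def arg bin by (simp add: diff_divide_distrib right_diff_distrib)
  qed
  finally show ?thesis .
qed

text \<open>
  For \<open>2 * j \<le> M\<close> the two values compared by \<open>binomial_sum_shift_nonneg\<close> are the two sides of
  log-concavity at the points \<open>\<mu> + j \<le> \<mu> + \<beta> + j\<close> with step \<open>M - 2 * j\<close>.
\<close>

lemma mirror_product_args:
  assumes "2 * j \<le> M"
  shows "mirror_product h \<mu> \<beta> M j = h (\<mu> + real j) * h (\<mu> + \<beta> + real j + real (M - 2 * j))"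
    and "mirror_product h \<mu> \<beta> M (M - j) = h (\<mu> + real j + real (M - 2 * j)) * h (\<mu> + \<beta> + real j)"
proof -
  have arg: "real (M - j) = real j + real (M - 2 * j)" "M - (M - j) = j"
    using assms by auto
  show "mirror_product h \<mu> \<beta> M j = h (\<mu> + real j) * h (\<mu> + \<beta> + real j + real (M - 2 * j))"
    and "mirror_product h \<mu> \<beta> M (M - j) = h (\<mu> + real j + real (M - 2 * j)) * h (\<mu> + \<beta> + real j)"
    unfolding mirror_product_def arg by (simp_all only: add.assoc)
qed

lemma delta_coeff_nonneg:
  assumes "elem_sym_chain a b" and "\<forall>t\<in>set a. 0 < t" "\<forall>t\<in>set b. 0 < t" and "0 \<le> \<mu>" "0 \<le> \<beta>"
  shows "0 \<le> delta_coeff a b \<mu> (real n) \<beta> m"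
proof -
  have "0 \<le> fact m * delta_coeff a b \<mu> (real n) \<beta> m"
    unfolding fact_mult_delta_coeff
  proof (rule binomial_sum_shift_nonneg)
    fix j assume j: "2 * j \<le> m + n"
    show "mirror_product (Gamma_ratio a b) \<mu> \<beta> (m + n) j
        \<le> mirror_product (Gamma_ratio a b) \<mu> \<beta> (m + n) (m + n - j)"
      unfolding mirror_product_args[OF j] by (intro Gamma_ratio_log_concave) (use assms in auto)
  qed
  thus ?thesis
    by (simp add: zero_le_mult_iff not_le[THEN iffD2, OF fact_gt_zero])
qed

lemma delta_coeff_nonpos:
  assumes "elem_sym_chain b a" and "\<forall>t\<in>set a. 0 < t" "\<forall>t\<in>set b. 0 < t" and "0 \<le> \<mu>" "0 \<le> \<beta>"
  shows "delta_coeff a b \<mu> (real n) \<beta> m \<le> 0"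
proof -
  let ?A = "mirror_product (Gamma_ratio a b) \<mu> \<beta> (m + n)"
  have "0 \<le> (\<Sum>k\<le>m. real (m choose k) * (- ?A (k + n) - - ?A k))"
  proof (rule binomial_sum_shift_nonneg)
    fix j assume j: "2 * j \<le> m + n"
    show "- ?A j \<le> - ?A (m + n - j)"
      unfolding mirror_product_args[OF j] neg_le_iff_le
      by (intro Gamma_ratio_log_convex) (use assms in auto)
  qed
  also have "\<dots> = - (fact m * delta_coeff a b \<mu> (real n) \<beta> m)"
    unfolding fact_mult_delta_coeff sum_negf[symmetric] by (intro sum.cong refl) (simp add: algebra_simps)
  finally show ?thesis
    by (simp add: mult_le_0_iff not_le[THEN iffD2, OF fact_gt_zero])
qed

theorem theorem3:
  fixes p q :: nat and a b :: "real list"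
  assumes "length a = p" and "length b = q" and "p \<le> q + 1"
    and "\<forall>t\<in>set a. 0 < t" and "\<forall>t\<in>set b. 0 < t"
  shows
    "(p \<le> q \<and>
      (\<forall>j\<in>{1..p}. elem_sym (q - p + j) b / elem_sym j a
                 \<le> elem_sym (q - p + j - 1) b / elem_sym (j - 1) a)
      \<longrightarrow>
      (\<forall>(\<mu>::real) (\<beta>::real) (\<alpha>::nat). 0 \<le> \<mu> \<and> 0 \<le> \<beta> \<and> 1 \<le> \<alpha> \<longrightarrow>
        (\<forall>x\<ge>0. 0 \<le> Delta_f a b \<mu> (real \<alpha>) \<beta> x) \<and>
        (real \<alpha> \<le> \<beta> + 1 \<longrightarrow> (\<forall>m. 0 \<le> delta_coeff a b \<mu> (real \<alpha>) \<beta> m))))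
     \<and>
     (q \<le> p \<and>
      (\<forall>j\<in>{1..q}. elem_sym (p - q + j) a / elem_sym j b
                 \<le> elem_sym (p - q + j - 1) a / elem_sym (j - 1) b)
      \<longrightarrow>
      (\<forall>(\<mu>::real) (\<beta>::real) (\<alpha>::nat). 0 \<le> \<mu> \<and> 0 \<le> \<beta> \<and> 1 \<le> \<alpha> \<longrightarrow>
        (\<forall>x\<ge>0. (p = q + 1 \<longrightarrow> x < 1) \<longrightarrow> Delta_f a b \<mu> (real \<alpha>) \<beta> x \<le> 0) \<and>
        (real \<alpha> \<le> \<beta> + 1 \<longrightarrow> (\<forall>m. delta_coeff a b \<mu> (real \<alpha>) \<beta> m \<le> 0))))"
proof -
  note len = assms(1,2) and len_le = assms(3) and pos = assms(4,5)
  have sums: "(\<lambda>m. delta_coeff a b \<mu> (real \<alpha>) \<beta> m * x ^ m) sums Delta_f a b \<mu> (real \<alpha>) \<beta> x"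
    if "0 \<le> \<mu>" "0 \<le> \<beta>" "0 \<le> x" "p = q + 1 \<longrightarrow> x < 1" for \<mu> \<beta> x :: real and \<alpha> :: nat
    using that len len_le pos by (intro Delta_f_sums) auto
  have Delta_nonneg: "0 \<le> Delta_f a b \<mu> (real \<alpha>) \<beta> x"
    if "elem_sym_chain a b" "0 \<le> \<mu>" "0 \<le> \<beta>" "0 \<le> x" for \<mu> \<beta> x :: real and \<alpha> :: nat
  proof (rule sums_le[OF _ sums_zero sums])
    show "0 \<le> delta_coeff a b \<mu> (real \<alpha>) \<beta> m * x ^ m" for m
      using that pos by (intro mult_nonneg_nonneg delta_coeff_nonneg) auto
  qed (use that len in \<open>auto simp: elem_sym_chain_def\<close>)
  have Delta_nonpos: "Delta_f a b \<mu> (real \<alpha>) \<beta> x \<le> 0"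
    if "elem_sym_chain b a" "0 \<le> \<mu>" "0 \<le> \<beta>" "0 \<le> x" "p = q + 1 \<longrightarrow> x < 1"
    for \<mu> \<beta> x :: real and \<alpha> :: nat
  proof (rule sums_le[OF _ sums sums_zero])
    show "delta_coeff a b \<mu> (real \<alpha>) \<beta> m * x ^ m \<le> 0" for m
      using that pos by (intro mult_nonpos_nonneg delta_coeff_nonpos) auto
  qed (use that in auto)
  have chain_ab: "elem_sym_chain a b \<longleftrightarrow> p \<le> q \<and>
      (\<forall>j\<in>{1..p}. elem_sym (q - p + j) b / elem_sym j a
                 \<le> elem_sym (q - p + j - 1) b / elem_sym (j - 1) a)"
    and chain_ba: "elem_sym_chain b a \<longleftrightarrow> q \<le> p \<and>
      (\<forall>j\<in>{1..q}. elem_sym (p - q + j) a / elem_sym j b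
                 \<le> elem_sym (p - q + j - 1) a / elem_sym (j - 1) b)"
    unfolding elem_sym_chain_def len by (rule refl)+
  show ?thesis
    unfolding chain_ab[symmetric] chain_ba[symmetric]
  proof (intro conjI impI allI)
    fix \<mu> \<beta> x :: real and \<alpha> m :: nat
    assume range: "0 \<le> \<mu> \<and> 0 \<le> \<beta> \<and> 1 \<le> \<alpha>"
    show "0 \<le> Delta_f a b \<mu> (real \<alpha>) \<beta> x" if "elem_sym_chain a b" "0 \<le> x"
      using Delta_nonneg range that by simp
    show "0 \<le> delta_coeff a b \<mu> (real \<alpha>) \<beta> m" if "elem_sym_chain a b"
      using delta_coeff_nonneg range that pos by simp
    show "Delta_f a b \<mu> (real \<alpha>) \<beta> x \<le> 0" if "elem_sym_chain b a" "0 \<le> x" "p = q + 1 \<longrightarrow> x < 1"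
      using Delta_nonpos range that by simp
    show "delta_coeff a b \<mu> (real \<alpha>) \<beta> m \<le> 0" if "elem_sym_chain b a"
      using delta_coeff_nonpos range that pos by simp
  qed
qed

end
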